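(* If $n\ge 3$ is odd, then $$\frac{2}{n}\left(1+\frac{2}{(n-1)(n+2)}\right)<\gamma_{\mathbb G_n}(0;e_2)<\frac{2}{n}\left(1+\frac{2}{(n-1)(n+1)}\right).$$
   Context: $\mathbb D$ is the open unit disc in $\mathbb C$, and $\mathcal O(D,\mathbb D)$ is the set of holomorphic maps $D\to\mathbb D$. Let $\sigma_n=(\sigma_{n,1},\dots,\sigma_{n,n}):\mathbb C^n\to\mathbb C^n$, $\sigma_{n,k}(z_1,\dots,z_n)=\sum_{1\le j_1<\dots<j_k\le n}z_{j_1}\cdots z_{j_k}$, $1\le k\le n$. The symmetrized $n$-disc is the domain $\mathbb G_n=\sigma_n(\mathbb D^n)\subset\mathbb C^n$. Let $e_1,\dots,e_n$ be the standard basis of $\mathbb C^n$. For a domain $D\subset\mathbb C^n$, $z\in D$, $X\in\mathbb C^n$, the Carathéodory–Reiffen pseudometric is $\gamma_D(z;X)=\sup\{|f'(z)X|: f\in\mathcal O(D,\mathbb D), f(z)=0\}$. *)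

theory Defs
  imports "HOL-Analysis.Analysis"
begin

text \<open>
  Complex \<open>n\<close>-space is \<^typ>\<open>complex^'n\<close> with \<open>n = CARD('n)\<close>. The linear order on the index type
  numbers the coordinates: \<open>coord_index\<close> is the order isomorphism onto \<open>{1..CARD('n)}\<close>.
\<close>

definition coord_index :: "'n::{finite,linorder} \<Rightarrow> nat" where
  "coord_index i = card {..i}"

lemma strict_mono_coord_index: "strict_mono (coord_index :: 'n::{finite,linorder} \<Rightarrow> nat)"
proof (rule strict_monoI)
  fix i j :: 'n
  assume "i < j"
  then have "{..i} \<subset> {..j}"
    by auto
  then show "coord_index i < coord_index j"
    unfolding coord_index_def by (intro psubset_card_mono) auto
qed

lemma bij_betw_coord_index:
  "bij_betw coord_index (UNIV :: 'n::{finite,linorder} set) {1..CARD('n)}"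
proof -
  have inj: "inj (coord_index :: 'n \<Rightarrow> nat)"
    by (rule strict_mono_imp_inj_on[OF strict_mono_coord_index])
  have "1 \<le> coord_index i \<and> coord_index i \<le> CARD('n)" for i :: 'n
  proof
    have "card {i} \<le> card {..i}"
      by (intro card_mono) auto
    then show "1 \<le> coord_index i"
      by (simp add: coord_index_def)
    show "coord_index i \<le> CARD('n)"
      unfolding coord_index_def by (intro card_mono) auto
  qed
  then have "range (coord_index :: 'n \<Rightarrow> nat) \<subseteq> {1..CARD('n)}"
    by auto
  moreover have "card (range (coord_index :: 'n \<Rightarrow> nat)) = card {1..CARD('n)}"
    using card_image[OF inj] by simp
  ultimately have "range (coord_index :: 'n \<Rightarrow> nat) = {1..CARD('n)}"
    by (intro card_subset_eq) auto
  with inj show ?thesis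
    by (simp add: bij_betw_def)
qed

definition std_basis :: "nat \<Rightarrow> complex ^ 'n::{finite,linorder}" where
  "std_basis k = (\<chi> i. if coord_index i = k then 1 else 0)"

text \<open>An increasing tuple \<open>j\<^sub>1 < \<dots> < j\<^sub>k\<close> of indices is represented by its underlying \<open>k\<close>-element set.\<close>

definition elem_sym :: "nat \<Rightarrow> complex ^ 'n \<Rightarrow> complex" where
  "elem_sym k z = (\<Sum>J | card J = k. \<Prod>j\<in>J. z $ j)"

definition symmetrization :: "complex ^ 'n::{finite,linorder} \<Rightarrow> complex ^ 'n::{finite,linorder}" where
  "symmetrization z = (\<chi> i. elem_sym (coord_index i) z)"

definition polydisc :: "(complex ^ 'n) set" where
  "polydisc = {z. \<forall>i. z $ i \<in> ball 0 1}"

definition symmetrized_disc :: "(complex ^ 'n::{finite,linorder}) set" where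
  "symmetrized_disc = symmetrization ` polydisc"

text \<open>
  \<open>has_derivative\<close> only makes the derivative real-linear; holomorphy in several variables asks for
  complex linearity, where \<open>*s\<close> is the complex scalar multiplication. The set \<open>D\<close> is meant to be open.
\<close>

definition holomorphic_several :: "(complex ^ 'n \<Rightarrow> complex) \<Rightarrow> (complex ^ 'n) set \<Rightarrow> bool" where
  "holomorphic_several f D \<longleftrightarrow>
     (\<forall>z\<in>D. \<exists>L. (f has_derivative L) (at z) \<and> (\<forall>c v. L (c *s v) = c * L v))"

definition holomorphic_to_disc :: "(complex ^ 'n) set \<Rightarrow> (complex ^ 'n \<Rightarrow> complex) set" where
  "holomorphic_to_disc D = {f. holomorphic_several f D \<and> f ` D \<subseteq> ball 0 1}"

text \<open>
  For open \<open>D\<close> and \<open>z \<in> D\<close> the set below contains \<open>0\<close> and is bounded above, by the Schwarz lemma on a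
  disc around \<open>z\<close> in direction \<open>X\<close>, so the real supremum is the true one.
\<close>

definition caratheodory_reiffen :: "(complex ^ 'n) set \<Rightarrow> complex ^ 'n \<Rightarrow> complex ^ 'n \<Rightarrow> real" where
  "caratheodory_reiffen D z X =
     Sup {cmod (frechet_derivative f (at z) X) | f. f \<in> holomorphic_to_disc D \<and> f z = 0}"

end

theory Submission
  imports Defs "HOL-Complex_Analysis.Conformal_Mappings"
    "HOL-Computational_Algebra.Fundamental_Theorem_Algebra"
begin

text \<open>
  If \<open>f\<close> maps the symmetrized disc to the disc and \<open>f 0 = 0\<close>, the second Taylor coefficient of
  \<open>x \<mapsto> f (\<sigma> (x z))\<close> has the form \<open>\<kappa> \<sigma>\<^sub>1(z)\<^sup>2 + c \<sigma>\<^sub>2(z)\<close> with \<open>c = f'(0) e\<^sub>2\<close>, and by Cauchy's inequality its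
  modulus is at most \<open>1\<close> for \<open>z\<close> in the closed polydisc; conversely such a quadratic form is itself a
  competitor. Hence \<open>\<gamma>(0; e\<^sub>2) = 2 / M\<close>, where \<open>M\<close> is the minimum over \<open>t\<close> of the maximum of
  \<open>\<bar>\<Sum>z\<^sub>j\<^sup>2 - t (\<Sum>z\<^sub>j)\<^sup>2\<bar>\<close>.

  For the upper bound write \<open>n = 2 m + 1\<close> and use the points with \<open>m + 1\<close> coordinates \<open>1\<close> and \<open>m\<close>
  coordinates \<open>-u\<close>, where \<open>u\<close> is \<open>1\<close>, \<open>\<i>\<close> or \<open>-\<i>\<close>. For the lower bound take \<open>t = 2 / (n + 1)\<close>: after a
  rotation only the real part of the form matters, and it is at most \<open>n - t\<close> because
  \<open>(\<Sum>x\<^sub>j)\<^sup>2 + \<Sum>(1 - x\<^sub>j\<^sup>2) \<ge> 1\<close> for an odd number of \<open>x\<^sub>j\<close> in \<open>[-1, 1]\<close>. Where it equals \<open>n - t\<close>, the form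
  decreases in \<open>t\<close>, so a slightly larger \<open>t\<close> does strictly better.
\<close>

section \<open>Holomorphic maps of one and several variables\<close>

lemma has_derivative_vec_lambda:
  fixes g :: "'a::real_normed_vector \<Rightarrow> 'n::finite \<Rightarrow> complex"
  assumes "\<And>i. ((\<lambda>x. g x i) has_derivative (\<lambda>h. g' h i)) F"
  shows "((\<lambda>x. \<chi> i. g x i) has_derivative (\<lambda>h. \<chi> i. g' h i)) F"
proof -
  have axis: "(\<chi> i. v i) = (\<Sum>i\<in>UNIV. axis i (v i))" for v :: "'n \<Rightarrow> complex"
    by (simp add: vec_eq_iff axis_def)
  have "bounded_linear (axis i :: complex \<Rightarrow> complex ^ 'n)" for i
    by (intro linear_conv_bounded_linear[THEN iffD1] linearI) (auto simp: vec_eq_iff axis_def)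
  then have "((\<lambda>x. axis i (g x i)) has_derivative (\<lambda>h. axis i (g' h i))) F" for i
    using bounded_linear.has_derivative[OF _ assms] by blast
  then show ?thesis
    unfolding axis by (intro has_derivative_sum) 
qed

text \<open>Chain rule: the inner derivative in direction \<open>h\<close> is \<open>h\<close> times
  a fixed vector, so complex linearity of \<open>L\<close> turns a derivative that is only
  real-linear a priori into multiplication by a complex number.\<close>

lemma holomorphic_on_several_compose:
  fixes f :: "complex ^ 'n::finite \<Rightarrow> complex" and \<gamma> :: "complex \<Rightarrow> 'n \<Rightarrow> complex"
  assumes f: "holomorphic_several f D"
    and \<gamma>: "\<And>i. (\<lambda>x. \<gamma> x i) holomorphic_on S" and S: "open S"
    and D: "\<And>x. x \<in> S \<Longrightarrow> (\<chi> i. \<gamma> x i) \<in> D"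
  shows "(\<lambda>x. f (\<chi> i. \<gamma> x i)) holomorphic_on S"
  unfolding holomorphic_on_open[OF S]
proof (intro ballI)
  fix x assume x: "x \<in> S"
  define \<gamma>' where "\<gamma>' i = deriv (\<lambda>x. \<gamma> x i) x" for i
  have "((\<lambda>x. \<gamma> x i) has_field_derivative \<gamma>' i) (at x)" for i
    unfolding \<gamma>'_def by (rule holomorphic_derivI[OF \<gamma> S x])
  then have "((\<lambda>x. \<gamma> x i) has_derivative (\<lambda>h. h * \<gamma>' i)) (at x)" for i
    by (simp add: has_field_derivative_def mult.commute[of _ "\<gamma>' i"])
  then have 1: "((\<lambda>x. \<chi> i. \<gamma> x i) has_derivative (\<lambda>h. \<chi> i. h * \<gamma>' i)) (at x)"
    by (rule has_derivative_vec_lambda)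
  obtain L where L: "(f has_derivative L) (at (\<chi> i. \<gamma> x i))" "\<And>c v. L (c *s v) = c * L v"
    using f D[OF x] unfolding holomorphic_several_def by blast
  have "((\<lambda>x. f (\<chi> i. \<gamma> x i)) has_derivative (\<lambda>h. L (\<chi> i. h * \<gamma>' i))) (at x)"
    by (rule has_derivative_compose[OF 1 L(1)])
  moreover have "L (\<chi> i. h * \<gamma>' i) = L (\<chi> i. \<gamma>' i) * h" for h
    using L(2)[of h "\<chi> i. \<gamma>' i"] by (simp add: vector_scalar_mult_def)
  ultimately show "\<exists>f'. ((\<lambda>x. f (\<chi> i. \<gamma> x i)) has_field_derivative f') (at x)"
    unfolding has_field_derivative_def by (auto simp: fun_eq_iff intro!: exI[of _ "L (\<chi> i. \<gamma>' i)"] elim!: has_derivative_eq_rhs)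
qed

section \<open>One-variable estimates from the Schwarz lemma and Cauchy's inequality\<close>

lemma scaled_Schwarz_Lemma:
  assumes hol: "\<phi> holomorphic_on ball 0 R" and R: "0 < R" and M: "0 < M"
    and bd: "\<And>z. cmod z < R \<Longrightarrow> cmod (\<phi> z) < M" and zero: "\<phi> 0 = 0" and z: "cmod z < R"
  shows "cmod (\<phi> z) \<le> M * cmod z / R"
proof -
  define \<psi> where "\<psi> w = \<phi> (of_real R * w) / of_real M" for w
  have "(\<lambda>w. \<phi> (of_real R * w)) holomorphic_on ball 0 1"
    by (rule holomorphic_on_compose_gen[OF _ hol, unfolded o_def])
       (use R in \<open>auto intro!: holomorphic_intros simp: norm_mult\<close>)
  then have 1: "\<psi> holomorphic_on ball 0 1"
    unfolding \<psi>_def by (rule holomorphic_on_divide) (use M in auto)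
  have 2: "cmod (\<psi> w) < 1" if "cmod w < 1" for w
    using bd[of "of_real R * w"] R M that by (simp add: \<psi>_def norm_mult norm_divide)
  have "cmod (\<psi> (z / of_real R)) \<le> cmod (z / of_real R)"
    by (rule Schwarz_Lemma(1)[OF 1 _ 2]) (use R z zero in \<open>auto simp: \<psi>_def norm_divide\<close>)
  then show ?thesis
    using R M by (simp add: \<psi>_def norm_divide field_simps)
qed

text \<open>The mixed difference vanishes on both axes, so Schwarz applies twice: first in
  \<open>x\<close> to \<open>H x y - H 0 y\<close>, then in \<open>y\<close> to the difference of
  two such expressions.\<close>

lemma mixed_difference_bound:
  assumes R: "0 < R"
    and hol1: "\<And>y. cmod y < R \<Longrightarrow> (\<lambda>x. H x y) holomorphic_on ball 0 R"
    and hol2: "\<And>x. cmod x < R \<Longrightarrow> (\<lambda>y. H x y) holomorphic_on ball 0 R"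
    and bd: "\<And>x y. cmod x < R \<Longrightarrow> cmod y < R \<Longrightarrow> cmod (H x y) < 1"
    and x: "cmod x < R" and y: "cmod y < R"
  shows "cmod (H x y - H x 0 - H 0 y + H 0 0) \<le> 5 * cmod x * cmod y / R\<^sup>2"
proof (cases "x = 0")
  case False
  have *: "cmod (H x y - H 0 y) \<le> 2 * cmod x / R" if y: "cmod y < R" for y
  proof (rule scaled_Schwarz_Lemma[where \<phi> = "\<lambda>x. H x y - H 0 y"])
    show "(\<lambda>x. H x y - H 0 y) holomorphic_on ball 0 R"
      by (intro holomorphic_intros hol1 y)
    fix z assume "cmod z < R"
    then show "cmod (H z y - H 0 y) < 2"
      using norm_triangle_ineq4[of "H z y" "H 0 y"] bd[of z y] bd[of 0 y] y R by simp
  qed (use R x in auto)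
  have "cmod ((H x y - H 0 y) - (H x 0 - H 0 0)) \<le> (5 * cmod x / R) * cmod y / R"
  proof (rule scaled_Schwarz_Lemma[where \<phi> = "\<lambda>y. (H x y - H 0 y) - (H x 0 - H 0 0)"])
    show "(\<lambda>y. (H x y - H 0 y) - (H x 0 - H 0 0)) holomorphic_on ball 0 R"
      by (intro holomorphic_intros hol2) (use R x in auto)
    fix z assume "cmod z < R"
    then have "cmod ((H x z - H 0 z) - (H x 0 - H 0 0)) \<le> 4 * cmod x / R"
      using norm_triangle_ineq4[of "H x z - H 0 z" "H x 0 - H 0 0"] *[of z] *[of 0] R by simp
    \<comment> \<open>Two applications of the first estimate give the constant 4; it is enlarged to
      5 because the Schwarz lemma asks for a strict bound.\<close>
    also have "\<dots> < 5 * cmod x / R"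
      using R False by (simp add: divide_strict_right_mono)
    finally show "cmod ((H x z - H 0 z) - (H x 0 - H 0 0)) < 5 * cmod x / R" .
  qed (use R x y False in auto)
  then show ?thesis
    by (simp add: algebra_simps power2_eq_square)
qed simp

text \<open>On a small circle of radius \<open>r\<close> the function is at most
  \<open>e/2 * r\<^sup>2\<close>, and Cauchy's inequality turns this into the bound \<open>e\<close>
  for the second derivative.\<close>

lemma second_deriv_eq_0_if_little_o:
  assumes hol: "\<phi> holomorphic_on ball 0 R" and R: "0 < R"
    and lim: "((\<lambda>x. \<phi> x / x\<^sup>2) \<longlongrightarrow> 0) (at 0)" and zero: "\<phi> 0 = 0"
  shows "(deriv ^^ 2) \<phi> 0 = 0"
proof -
  have "cmod ((deriv ^^ 2) \<phi> 0) \<le> 0 + e" if e: "e > 0" for e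
  proof -
    have "\<forall>\<^sub>F x in at 0. dist (\<phi> x / x\<^sup>2) 0 < e/2"
      using lim e by (intro tendstoD) auto
    then obtain d where d: "d > 0" "\<And>x. x \<noteq> 0 \<Longrightarrow> cmod x < d \<Longrightarrow> cmod (\<phi> x / x\<^sup>2) < e/2"
      unfolding eventually_at by auto
    define r where "r = min d R / 2"
    have r: "0 < r" "r < d" "r < R"
      using d R by (auto simp: r_def)
    have "cmod ((deriv ^^ 2) \<phi> 0) \<le> fact 2 * (e/2 * r\<^sup>2) / r^2"
    proof (rule Cauchy_inequality)
      show "\<phi> holomorphic_on ball 0 r"
        by (rule holomorphic_on_subset[OF hol]) (use r in auto)
      show "continuous_on (cball 0 r) \<phi>"
        by (rule holomorphic_on_imp_continuous_on, rule holomorphic_on_subset[OF hol]) (use r in auto)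
      fix x assume "cmod (0 - x) = r"
      then have x: "cmod x = r" "x \<noteq> 0"
        using r by auto
      then show "cmod (\<phi> x) \<le> e/2 * r\<^sup>2"
        using d(2)[of x] r by (auto simp: norm_divide norm_power field_simps)
    qed (use r in auto)
    then show ?thesis
      using r by simp
  qed
  then have "cmod ((deriv ^^ 2) \<phi> 0) \<le> 0"
    by (rule field_le_epsilon)
  then show ?thesis by simp
qed

text \<open>Continuity up to the unit circle is not assumed, so Cauchy's inequality is applied at
  radius \<open>r < 1\<close> and then \<open>r\<close> tends to 1.\<close>

lemma second_deriv_bound:
  assumes hol: "g holomorphic_on ball 0 1" and bd: "\<And>x. cmod x < 1 \<Longrightarrow> cmod (g x) \<le> 1"
  shows "cmod ((deriv ^^ 2) g 0) \<le> 2"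
proof -
  have *: "cmod ((deriv ^^ 2) g 0) * r\<^sup>2 \<le> 2" if r: "0 < r" "r < 1" for r
  proof -
    have "cmod ((deriv ^^ 2) g 0) \<le> fact 2 * 1 / r^2"
    proof (rule Cauchy_inequality)
      show "g holomorphic_on ball 0 r"
        by (rule holomorphic_on_subset[OF hol]) (use r in auto)
      show "continuous_on (cball 0 r) g"
        by (rule holomorphic_on_imp_continuous_on, rule holomorphic_on_subset[OF hol]) (use r in auto)
    qed (use r bd in auto)
    then show ?thesis using r by (simp add: field_simps)
  qed
  have "((\<lambda>r. cmod ((deriv ^^ 2) g 0) * r\<^sup>2) \<longlongrightarrow> cmod ((deriv ^^ 2) g 0) * 1\<^sup>2) (at_left 1)"
    by (intro tendsto_intros)
  moreover have "\<forall>\<^sub>F r in at_left (1::real). cmod ((deriv ^^ 2) g 0) * r\<^sup>2 \<le> 2"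
    using eventually_at_left_real[OF zero_less_one] by eventually_elim (use * in auto)
  ultimately show ?thesis
    by (auto dest: tendsto_upperbound)
qed

section \<open>Elementary symmetric polynomials\<close>

lemma sum_UNIV_coord_index:
  "(\<Sum>i\<in>(UNIV :: 'n::{finite,linorder} set). F (coord_index i)) = (\<Sum>k = 1..CARD('n). F k)"
  by (rule sum.reindex_bij_betw[OF bij_betw_coord_index])

lemma elem_sym_Suc_0: "elem_sym (Suc 0) z = (\<Sum>i\<in>UNIV. z $ i)"
proof -
  have "{J :: 'a set. card J = Suc 0} = (\<lambda>i. {i}) ` UNIV"
    by (auto simp: card_1_singleton_iff)
  then show ?thesis
    by (simp add: elem_sym_def sum.reindex inj_on_def)
qed

text \<open>Newton's identity: the square of the sum runs over all pairs of indices, which split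
  into the diagonal and two mirror images of the set of pairs \<open>i < j\<close>.\<close>

lemma elem_sym_2:
  fixes z :: "complex ^ 'n::{finite,linorder}"
  shows "2 * elem_sym 2 z = (\<Sum>i\<in>UNIV. z $ i)\<^sup>2 - (\<Sum>i\<in>UNIV. (z $ i)\<^sup>2)"
proof -
  let ?P = "{(i, j). i < j} :: ('n \<times> 'n) set" and ?Q = "{(i, j). j < i} :: ('n \<times> 'n) set"
    and ?D = "{(i, j). i = j} :: ('n \<times> 'n) set"
  have "bij_betw (\<lambda>(i, j). {i, j}) ?P {J :: 'n set. card J = 2}"
  proof (rule bij_betw_imageI)
    show "inj_on (\<lambda>(i, j). {i, j}) ?P"
      by (auto simp: inj_on_def doubleton_eq_iff)
    have "{i, j} \<in> (\<lambda>(i, j). {i, j}) ` ?P" if "i \<noteq> j" for i j :: 'n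
      using that by (cases i j rule: linorder_cases) (auto simp: image_iff insert_commute)
    then show "(\<lambda>(i, j). {i, j}) ` ?P = {J :: 'n set. card J = 2}"
      by (auto simp: card_2_iff)
  qed
  then have "elem_sym 2 z = (\<Sum>(i, j)\<in>?P. \<Prod>k\<in>{i, j}. z $ k)"
    unfolding elem_sym_def by (subst sum.reindex_bij_betw[symmetric]) (auto simp: case_prod_unfold)
  also have "\<dots> = (\<Sum>(i, j)\<in>?P. z $ i * z $ j)"
    by (intro sum.cong) auto
  finally have P: "elem_sym 2 z = (\<Sum>(i, j)\<in>?P. z $ i * z $ j)" .
  also have "\<dots> = (\<Sum>(i, j)\<in>?Q. z $ i * z $ j)"
    by (rule sum.reindex_bij_witness[of _ prod.swap prod.swap]) auto
  finally have Q: "elem_sym 2 z = (\<Sum>(i, j)\<in>?Q. z $ i * z $ j)" .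
  have D: "(\<Sum>i\<in>UNIV. (z $ i)\<^sup>2) = (\<Sum>(i, j)\<in>?D. z $ i * z $ j)"
    by (rule sum.reindex_bij_witness[of _ fst "\<lambda>i. (i, i)"]) (auto simp: power2_eq_square)
  have "(\<Sum>i\<in>UNIV. z $ i)\<^sup>2 = (\<Sum>(i, j)\<in>UNIV. z $ i * z $ j)"
    by (simp add: power2_eq_square sum_product sum.cartesian_product)
  also have "UNIV = (?P \<union> ?Q) \<union> ?D"
    by auto
  also have "(\<Sum>(i, j)\<in>\<dots>. z $ i * z $ j) = (elem_sym 2 z + elem_sym 2 z) + (\<Sum>i\<in>UNIV. (z $ i)\<^sup>2)"
    unfolding D by (subst sum.union_disjoint; (auto; fail)?)+ (use P Q in simp)
  finally show ?thesis by simp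
qed

lemma elem_sym_scale: "elem_sym k (c *s z) = c ^ k * elem_sym k z"
  by (simp add: elem_sym_def prod.distrib sum_distrib_left)

section \<open>Vieta's formulas and a neighbourhood of the origin\<close>

text \<open>Vieta: expanding the product, a subset \<open>J\<close> contributes the constant terms
  of its factors and its complement contributes the power of the variable.\<close>

lemma coeff_prod_linear_factors:
  fixes z :: "complex ^ 'n::finite"
  assumes "k \<le> CARD('n)"
  shows "coeff (\<Prod>i\<in>UNIV. [:- z $ i, 1:]) (CARD('n) - k) = (- 1) ^ k * elem_sym k z"
proof -
  let ?n = "CARD('n)"
  have "(\<Prod>i\<in>UNIV. [:- z $ i, 1:]) = (\<Prod>i\<in>UNIV. [:- z $ i:] + monom 1 1)"
    by (simp add: monom_altdef)
  also have "\<dots> = (\<Sum>J\<in>Pow UNIV. (\<Prod>i\<in>J. [:- z $ i:]) * monom 1 (card (- J)))"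
    by (subst prod_add) (auto simp: monom_power Compl_eq_Diff_UNIV)
  also have "\<dots> = (\<Sum>J\<in>UNIV. monom ((-1) ^ card J * (\<Prod>i\<in>J. z $ i)) (?n - card J))"
  proof (intro sum.cong)
    fix J :: "'n set"
    have "(\<Prod>i\<in>J. [:- z $ i:]) = [:(-1) ^ card J * (\<Prod>i\<in>J. z $ i):]"
      by (induction J rule: infinite_finite_induct) auto
    moreover have "card (- J) = ?n - card J"
      by (simp add: Compl_eq_Diff_UNIV card_Diff_subset)
    ultimately show "(\<Prod>i\<in>J. [:- z $ i:]) * monom 1 (card (- J)) =
      monom ((-1) ^ card J * (\<Prod>i\<in>J. z $ i)) (?n - card J)"
      by (simp add: smult_monom)
  qed auto
  also have "coeff \<dots> (?n - k) = (\<Sum>J\<in>UNIV. if card J = k then (-1) ^ card J * (\<Prod>i\<in>J. z $ i) else 0)"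
    unfolding coeff_sum
  proof (intro sum.cong refl)
    fix J :: "'n set"
    have "card J \<le> ?n"
      by (rule card_mono) auto
    with assms have "?n - card J = ?n - k \<longleftrightarrow> card J = k"
      by auto
    then show "coeff (monom ((-1) ^ card J * (\<Prod>i\<in>J. z $ i)) (?n - card J)) (?n - k) =
        (if card J = k then (-1) ^ card J * (\<Prod>i\<in>J. z $ i) else 0)"
      by simp
  qed
  also have "\<dots> = (\<Sum>J | card J = k. (-1) ^ k * (\<Prod>i\<in>J. z $ i))"
    by (subst sum.inter_filter[symmetric]) auto
  finally show ?thesis
    by (simp add: elem_sym_def sum_distrib_left)
qed

lemma monic_polynomial_splits:
  fixes p :: "complex poly"
  assumes "degree p = CARD('n::{finite,linorder})" and "lead_coeff p = 1"
  obtains z :: "complex ^ 'n::{finite,linorder}" where "p = (\<Prod>i\<in>UNIV. [:- z $ i, 1:])"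
proof -
  have "p \<noteq> 0"
    using assms by auto
  then obtain A where A: "size A = degree p" "p = (\<Prod>x\<in>#A. [:- x, 1:])"
    using alg_closed_imp_factorization[OF \<open>p \<noteq> 0\<close>] assms(2) by (metis smult_1_left)
  obtain xs where xs: "mset xs = A"
    using ex_mset by blast
  with A assms have len: "length xs = CARD('n)"
    by auto
  \<comment> \<open>Coordinates are numbered from 1 and list positions from 0.\<close>
  define z :: "complex ^ 'n::{finite,linorder}" where "z = (\<chi> i. xs ! (coord_index i - 1))"
  have "p = prod_list (map (\<lambda>x. [:- x, 1:]) xs)"
    using A xs by (metis mset_map prod_mset_prod_list)
  also have "\<dots> = (\<Prod>k = 0..<CARD('n). [:- xs ! k, 1:])"
    by (simp add: prod.list_conv_set_nth len)
  also have "\<dots> = (\<Prod>k = 1..CARD('n). [:- xs ! (k - 1), 1:])"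
    by (rule prod.reindex_bij_witness[of _ "\<lambda>k. k - 1" Suc]) auto
  also have "\<dots> = (\<Prod>i\<in>UNIV. [:- z $ i, 1:])"
    by (subst prod.reindex_bij_betw[OF bij_betw_coord_index, symmetric]) (simp add: z_def)
  finally show ?thesis
    by (rule that)
qed

text \<open>The point \<open>w\<close> collects, up to sign, the coefficients of a monic polynomial; its roots lie in the
  unit disc because the leading term dominates outside of it.\<close>

lemma symmetrized_disc_neighbourhood:
  fixes w :: "complex ^ 'n::{finite,linorder}"
  assumes w: "(\<Sum>i\<in>UNIV. cmod (w $ i)) < 1"
  shows "w \<in> symmetrized_disc"
proof -
  let ?n = "CARD('n)"
  define q where "q = (\<Sum>i\<in>(UNIV :: 'n set). monom ((-1) ^ coord_index i * w $ i) (?n - coord_index i))"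
  define p where "p = monom 1 ?n + q"
  have ci: "1 \<le> coord_index i" "coord_index i \<le> ?n" for i :: 'n
    using bij_betwE[OF bij_betw_coord_index] by (metis UNIV_I atLeastAtMost_iff)+
  have coeff_q: "coeff q (?n - coord_index i) = (-1) ^ coord_index i * w $ i" for i
  proof -
    \<comment> \<open>Distinct coordinates contribute monomials of distinct degrees, since no
      subtraction is truncated.\<close>
    have "?n - coord_index j = ?n - coord_index i \<longleftrightarrow> j = i" for j :: 'n
      using ci[of i] ci[of j] strict_mono_eq[OF strict_mono_coord_index, of j i] by auto
    then show ?thesis
      unfolding q_def coeff_sum by (simp add: sum.delta')
  qed
  have deg_q: "degree q < ?n"
    unfolding q_def using ci
    by (intro degree_sum_less) (auto intro!: le_less_trans[OF degree_monom_le] simp: less_le_trans Suc_le_lessD)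
  then have deg_p: "degree p = ?n" and lead_p: "lead_coeff p = 1"
    by (auto simp: p_def degree_add_eq_left degree_monom_eq coeff_eq_0)
  obtain z :: "complex ^ 'n::{finite,linorder}" where z: "p = (\<Prod>i\<in>UNIV. [:- z $ i, 1:])"
    using monic_polynomial_splits[OF deg_p lead_p] .
  have "symmetrization z $ i = w $ i" for i
  proof -
    have "(- 1) ^ coord_index i * elem_sym (coord_index i) z = coeff p (?n - coord_index i)"
      using coeff_prod_linear_factors[of "coord_index i" z] ci[of i] z by simp
    also have "\<dots> = (- 1) ^ coord_index i * w $ i"
      using ci[of i] coeff_q[of i] by (simp add: p_def)
    finally show ?thesis
      by (simp add: symmetrization_def)
  qed
  then have sym: "symmetrization z = w"
    by (simp add: vec_eq_iff)
  have "cmod (z $ i) < 1" for i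
  proof (rule ccontr)
    assume "\<not> cmod (z $ i) < 1"
    then have ge: "cmod (z $ i) \<ge> 1"
      by simp
    have "poly p (z $ i) = 0"
      unfolding z by (auto simp: poly_prod)
    then have "(z $ i) ^ ?n = - poly q (z $ i)"
      by (simp add: p_def poly_monom eq_neg_iff_add_eq_0)
    then have "cmod (z $ i) ^ ?n = cmod (poly q (z $ i))"
      by (metis norm_minus_cancel norm_power)
    also have "\<dots> \<le> (\<Sum>j\<in>UNIV. cmod (w $ j) * cmod (z $ i) ^ (?n - coord_index j))"
      unfolding q_def by (auto simp: poly_sum poly_monom norm_mult norm_power intro!: order.trans[OF norm_sum])
    also have "\<dots> \<le> (\<Sum>j\<in>UNIV. cmod (w $ j) * cmod (z $ i) ^ ?n)"
      using ge by (intro sum_mono mult_left_mono power_increasing) auto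
    also have "\<dots> = (\<Sum>j\<in>UNIV. cmod (w $ j)) * cmod (z $ i) ^ ?n"
      by (simp add: sum_distrib_right)
    also have "\<dots> < 1 * cmod (z $ i) ^ ?n"
      using w ge by (intro mult_strict_right_mono zero_less_power) auto
    finally show False by simp
  qed
  then have "z \<in> polydisc"
    by (simp add: polydisc_def)
  with sym show ?thesis
    unfolding symmetrized_disc_def by blast
qed

section \<open>The upper bound\<close>

lemma zero_in_symmetrized_disc: "(0 :: complex ^ 'n::{finite,linorder}) \<in> symmetrized_disc"
  by (rule symmetrized_disc_neighbourhood) simp

lemma coord_index_pos: "0 < coord_index (i :: 'n::{finite,linorder})"
  by (simp add: coord_index_def card_gt_0_iff)

text \<open>Restricted to a complex line, the derivative at the origin becomes the limit of a
  one-variable difference quotient; this is the form in which \<open>L\<close> enters the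
  second-order expansion.\<close>

lemma has_derivative_along_line:
  fixes f :: "complex ^ 'n::finite \<Rightarrow> complex"
  assumes L: "(f has_derivative L) (at 0)" and lin: "\<And>c v. L (c *s v) = c * L v" and zero: "f 0 = 0"
  shows "((\<lambda>y. f (\<chi> i. y * v $ i) / y) \<longlongrightarrow> L v) (at 0)"
proof -
  have "((\<lambda>y. \<chi> i. y * v $ i) has_derivative (\<lambda>y. \<chi> i. y * v $ i)) (at 0)"
    by (rule has_derivative_vec_lambda) (auto intro!: derivative_eq_intros)
  moreover have "(\<chi> i. (0 :: complex) * v $ i) = 0"
    by (simp add: vec_eq_iff)
  ultimately have "((\<lambda>y. f (\<chi> i. y * v $ i)) has_derivative (\<lambda>y. L (\<chi> i. y * v $ i))) (at 0)"
    using has_derivative_compose[of "\<lambda>y. \<chi> i. y * v $ i" _ 0 UNIV f L] L by simp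
  moreover have "L (\<chi> i. y * v $ i) = L v * y" for y
    using lin[of y v] by (simp add: vector_scalar_mult_def)
  ultimately have "((\<lambda>y. f (\<chi> i. y * v $ i)) has_field_derivative L v) (at 0)"
    by (simp add: has_field_derivative_def)
  then show ?thesis
    using zero \<open>(\<chi> i. (0 :: complex) * v $ i) = 0\<close> by (simp add: has_field_derivative_iff)
qed

text \<open>To avoid second derivatives in several variables, the curve \<open>x \<mapsto> \<sigma> (x z)\<close> is put on the surface
  \<open>V x y\<close> as \<open>y = x\<^sup>2\<close>; the mixed difference of \<open>f\<close> on it is of order \<open>x y = x\<^sup>3\<close>.\<close>

lemma second_taylor_coefficient:
  fixes f :: "complex ^ 'n::{finite,linorder} \<Rightarrow> complex" and z :: "complex ^ 'n::{finite,linorder}"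
  assumes f: "f \<in> holomorphic_to_disc symmetrized_disc" and zero: "f 0 = 0"
    and L: "(f has_derivative L) (at 0)" and lin: "\<And>c v. L (c *s v) = c * L v"
    and z: "\<And>i. cmod (z $ i) \<le> 1"
  shows "cmod ((deriv ^^ 2) (\<lambda>u. f (\<chi> i. u * std_basis 1 $ i)) 0 / 2 * (elem_sym 1 z)\<^sup>2
     + L (std_basis 2) * elem_sym 2 z) \<le> 1"
proof -
  have hol: "holomorphic_several f symmetrized_disc"
    and bd: "\<And>w. w \<in> symmetrized_disc \<Longrightarrow> cmod (f w) < 1"
    using f by (auto simp: holomorphic_to_disc_def)
  define s where "s k = elem_sym k z" for k
  define c where "c = L (std_basis 2) * s 2"
  define K where "K u = f (\<chi> i. u * std_basis 1 $ i)" for u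
  define g where "g x = f (symmetrization (x *s z))" for x
  \<comment> \<open>For index \<open>k \<ge> 2\<close> two powers of \<open>x\<close> are traded for
    \<open>y\<close>. Setting \<open>y = 0\<close> leaves only the first coordinate; setting
    \<open>x = 0\<close> leaves only the second, because \<open>0 ^ 0 = 1\<close>.\<close>
  define V where "V x y i = (let k = coord_index i in if k = 1 then x * s 1 else y * x ^ (k - 2) * s k)"
    for x y :: complex and i :: 'n
  define H where "H x y = f (\<chi> i. V x y i)" for x y
  define S where "S = (\<Sum>i\<in>(UNIV :: 'n set). cmod (s (coord_index i)))"
  \<comment> \<open>With this radius the moduli of the coordinates of \<open>V x y\<close> sum to at
    most \<open>R * S < 1\<close>, so the surface stays in the symmetrized disc.\<close>
  define R where "R = 1 / (1 + S)"
  have S: "0 \<le> S"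
    unfolding S_def by (intro sum_nonneg) auto
  have R: "0 < R" "R \<le> 1" "R * S < 1"
    using S by (auto simp: R_def field_simps)
  have V_le: "cmod (V x y i) \<le> R * cmod (s (coord_index i))" if "cmod x < R" "cmod y < R" for x y i
  proof (cases "coord_index i = 1")
    case True
    then show ?thesis
      using that by (simp add: V_def norm_mult mult_right_mono)
  next
    case False
    have "cmod x ^ (coord_index i - 2) \<le> 1"
      using that R by (intro power_le_one) auto
    then have "cmod y * cmod x ^ (coord_index i - 2) \<le> R * 1"
      using that R by (intro mult_mono) auto
    with False show ?thesis
      by (simp add: V_def Let_def norm_mult norm_power mult_right_mono)
  qed
  have V_in: "(\<chi> i. V x y i) \<in> symmetrized_disc" if "cmod x < R" "cmod y < R" for x y
  proof (rule symmetrized_disc_neighbourhood)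
    have "(\<Sum>i\<in>UNIV. cmod ((\<chi> i. V x y i) $ i)) \<le> (\<Sum>i\<in>UNIV. R * cmod (s (coord_index (i :: 'n))))"
      using V_le[OF that] by (intro sum_mono) auto
    also have "\<dots> < 1"
      using R(3) by (simp add: S_def sum_distrib_left)
    finally show "(\<Sum>i\<in>UNIV. cmod ((\<chi> i. V x y i) $ i)) < 1" .
  qed
  have mixed: "cmod (H x y - H x 0 - H 0 y + H 0 0) \<le> 5 * cmod x * cmod y / R\<^sup>2"
    if "cmod x < R" "cmod y < R" for x y
  proof (rule mixed_difference_bound[OF R(1) _ _ _ that])
    fix y assume y: "cmod y < R"
    have "(\<lambda>x. V x y i) holomorphic_on ball 0 R" for i
      by (cases "coord_index i = 1") (auto simp: V_def Let_def intro!: holomorphic_intros)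
    then show "(\<lambda>x. H x y) holomorphic_on ball 0 R"
      unfolding H_def using y V_in by (intro holomorphic_on_several_compose[OF hol]) auto
  next
    fix x assume x: "cmod x < R"
    have "(\<lambda>y. V x y i) holomorphic_on ball 0 R" for i
      by (cases "coord_index i = 1") (auto simp: V_def Let_def intro!: holomorphic_intros)
    then show "(\<lambda>y. H x y) holomorphic_on ball 0 R"
      unfolding H_def using x V_in by (intro holomorphic_on_several_compose[OF hol]) auto
  next
    fix x y assume "cmod x < R" "cmod y < R"
    then show "cmod (H x y) < 1"
      unfolding H_def by (intro bd V_in)
  qed
  have H_diag: "H x (x\<^sup>2) = g x" for x
  proof -
    have "V x (x\<^sup>2) i = symmetrization (x *s z) $ i" for i
    proof (cases "coord_index i = 1")
      case True
      then show ?thesis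
        by (simp add: V_def symmetrization_def elem_sym_scale s_def)
    next
      case False
      then have "coord_index i = 2 + (coord_index i - 2)"
        using coord_index_pos[of i] by linarith
      then have "x\<^sup>2 * x ^ (coord_index i - 2) = x ^ coord_index i"
        by (metis power_add)
      moreover have "V x (x\<^sup>2) i = (x\<^sup>2 * x ^ (coord_index i - 2)) * s (coord_index i)"
        using False by (simp add: V_def Let_def)
      ultimately show ?thesis
        by (simp add: symmetrization_def elem_sym_scale s_def)
    qed
    then have "(\<chi> i. V x (x\<^sup>2) i) = symmetrization (x *s z)"
      by (simp add: vec_eq_iff)
    then show ?thesis
      by (simp add: H_def g_def)
  qed
  have H_x0: "H x 0 = K (s 1 * x)" for x
    unfolding H_def K_def by (rule arg_cong[of _ _ f]) (auto simp: vec_eq_iff V_def std_basis_def Let_def)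
  have H_0y: "H 0 y = f (\<chi> i. y * (s 2 *s std_basis 2) $ i)" for y
    unfolding H_def
  proof (rule arg_cong[of _ _ f])
    have "V 0 y i = y * (s 2 *s std_basis 2) $ i" for i
      using coord_index_pos[of i] by (auto simp: V_def std_basis_def Let_def power_0_left)
    then show "(\<chi> i. V 0 y i) = (\<chi> i. y * (s 2 *s std_basis 2) $ i)"
      by simp
  qed
  have H_00: "H 0 0 = 0"
    using zero by (simp add: H_0y vec_lambda_eta zero_vec_def)
  have K_hol: "K holomorphic_on ball 0 1"
    unfolding K_def
  proof (rule holomorphic_on_several_compose[OF hol])
    fix u :: complex assume u: "u \<in> ball 0 1"
    show "(\<chi> i. u * std_basis 1 $ i) \<in> (symmetrized_disc :: (complex ^ 'n::{finite,linorder}) set)"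
    proof (rule symmetrized_disc_neighbourhood)
      have "(\<Sum>i\<in>(UNIV :: 'n set). cmod (u * std_basis 1 $ i)) = (\<Sum>k = 1..CARD('n). if k = 1 then cmod u else 0)"
        unfolding std_basis_def by (subst sum_UNIV_coord_index[symmetric]) (auto intro!: sum.cong)
      also have "\<dots> \<le> cmod u"
        by (simp add: sum.delta)
      finally show "(\<Sum>i\<in>(UNIV :: 'n set). cmod ((\<chi> i. u * std_basis 1 $ i) $ i)) < 1"
        using u by simp
    qed
  qed (auto intro!: holomorphic_intros)
  have s1R: "s 1 * x \<in> ball 0 1" if "x \<in> ball 0 R" for x
  proof -
    have "1 \<in> {1..CARD('n)}"
      by (simp add: Suc_leI)
    then obtain i :: 'n where i: "coord_index i = 1"
      using bij_betw_imp_surj_on[OF bij_betw_coord_index] by (metis imageE)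
    have "cmod (s 1) \<le> S"
      unfolding S_def using i member_le_sum[of i UNIV "\<lambda>i. cmod (s (coord_index i))"] by simp
    then have "cmod x * cmod (s 1) \<le> R * S"
      using that R by (intro mult_mono) auto
    then show ?thesis
      using R by (simp add: norm_mult mult.commute)
  qed
  have g_in: "symmetrization (x *s z) \<in> symmetrized_disc" if "x \<in> ball 0 1" for x
  proof -
    have "cmod (x * z $ i) < 1" for i
      using that z[of i] mult_left_le[of "cmod (z $ i)" "cmod x"] by (simp add: norm_mult le_less_trans)
    then show ?thesis
      by (auto simp: symmetrized_disc_def polydisc_def)
  qed
  have g_hol: "g holomorphic_on ball 0 1"
  proof -
    have *: "symmetrization (x *s z) = (\<chi> i. x ^ coord_index i * s (coord_index i))" for x
      by (simp add: symmetrization_def elem_sym_scale s_def)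
    show ?thesis
      unfolding g_def * using g_in[unfolded *]
      by (intro holomorphic_on_several_compose[OF hol]) (auto intro!: holomorphic_intros)
  qed
  \<comment> \<open>What remains of \<open>g\<close> after removing its part along the first axis
    and the expected quadratic term. It is the mixed difference at \<open>y = x\<^sup>2\<close> plus
    the error of linearising \<open>H 0\<close> there, and both are
    \<open>o(x\<^sup>2)\<close>.\<close>
  define \<phi> where "\<phi> x = (g x - K (s 1 * x)) - c * x\<^sup>2" for x
  have hols: "g holomorphic_on ball 0 R" "(\<lambda>x. K (s 1 * x)) holomorphic_on ball 0 R"
    "(\<lambda>x. c * x\<^sup>2) holomorphic_on ball 0 R"
  proof -
    show "g holomorphic_on ball 0 R"
      by (rule holomorphic_on_subset[OF g_hol]) (use R in auto)
    show "(\<lambda>x. K (s 1 * x)) holomorphic_on ball 0 R"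
      by (rule holomorphic_on_compose_gen[OF _ K_hol, unfolded o_def]) (use s1R in \<open>auto intro!: holomorphic_intros\<close>)
  qed (auto intro!: holomorphic_intros)
  have "(deriv ^^ 2) \<phi> 0 = 0"
  proof (rule second_deriv_eq_0_if_little_o[OF _ R(1)])
    show "\<phi> holomorphic_on ball 0 R"
      unfolding \<phi>_def by (intro holomorphic_intros hols)
    show "\<phi> 0 = 0"
      using H_diag[of 0] H_x0[of 0] by (simp add: \<phi>_def)
    have "((\<lambda>y. H 0 y / y) \<longlongrightarrow> c) (at 0)"
      using has_derivative_along_line[OF L lin zero, of "s 2 *s std_basis 2"] lin
      unfolding H_0y c_def by (simp add: mult.commute)
    moreover have "filterlim (\<lambda>x::complex. x\<^sup>2) (at 0) (at 0)"
      by (rule filterlim_atI) (auto intro!: tendsto_eq_intros simp: eventually_at_filter)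
    ultimately have "((\<lambda>x. H 0 (x\<^sup>2) / x\<^sup>2) \<longlongrightarrow> c) (at 0)"
      by (rule filterlim_compose)
    then have "((\<lambda>x. cmod (H 0 (x\<^sup>2) / x\<^sup>2 - c)) \<longlongrightarrow> 0) (at 0)"
      by (intro tendsto_norm_zero LIM_zero)
    moreover have "((\<lambda>x::complex. 5 * cmod x / R\<^sup>2) \<longlongrightarrow> 5 * cmod 0 / R\<^sup>2) (at 0)"
      using R by (intro tendsto_intros) auto
    ultimately have lim: "((\<lambda>x. 5 * cmod x / R\<^sup>2 + cmod (H 0 (x\<^sup>2) / x\<^sup>2 - c)) \<longlongrightarrow> 0) (at 0)"
      using tendsto_add by fastforce
    show "((\<lambda>x. \<phi> x / x\<^sup>2) \<longlongrightarrow> 0) (at 0)"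
    proof (rule Lim_null_comparison[OF _ lim])
      have "\<forall>\<^sub>F x in at 0. x \<noteq> 0 \<and> cmod x < R"
        unfolding eventually_at using R by auto
      then show "\<forall>\<^sub>F x in at 0. cmod (\<phi> x / x\<^sup>2) \<le> 5 * cmod x / R\<^sup>2 + cmod (H 0 (x\<^sup>2) / x\<^sup>2 - c)"
      proof eventually_elim
        fix x :: complex assume x: "x \<noteq> 0 \<and> cmod x < R"
        \<comment> \<open>Since \<open>R \<le> 1\<close>, the point \<open>x\<^sup>2\<close> also
          lies in the disc of radius \<open>R\<close>, so \<open>mixed\<close> applies with
          \<open>y = x\<^sup>2\<close>.\<close>
        have "cmod x * cmod x \<le> cmod x"
          using x R by (intro mult_left_le) auto
        with x have x2: "cmod (x\<^sup>2) < R"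
          unfolding power2_eq_square norm_mult by linarith
        have "\<phi> x = (H x (x\<^sup>2) - H x 0 - H 0 (x\<^sup>2) + H 0 0) + (H 0 (x\<^sup>2) - c * x\<^sup>2)"
          unfolding \<phi>_def H_diag H_00 H_x0[symmetric] by simp
        then have "cmod (\<phi> x / x\<^sup>2) \<le> cmod (H x (x\<^sup>2) - H x 0 - H 0 (x\<^sup>2) + H 0 0) / cmod (x\<^sup>2)
            + cmod ((H 0 (x\<^sup>2) - c * x\<^sup>2) / x\<^sup>2)"
          by (metis add_divide_distrib norm_divide norm_triangle_ineq)
        also have "\<dots> \<le> (5 * cmod x * cmod (x\<^sup>2) / R\<^sup>2) / cmod (x\<^sup>2) + cmod (H 0 (x\<^sup>2) / x\<^sup>2 - c)"
          using mixed[of x "x\<^sup>2"] x x2 by (intro add_mono divide_right_mono) (auto simp: diff_divide_distrib)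
        also have "\<dots> = 5 * cmod x / R\<^sup>2 + cmod (H 0 (x\<^sup>2) / x\<^sup>2 - c)"
          using x by simp
        finally show "cmod (\<phi> x / x\<^sup>2) \<le> 5 * cmod x / R\<^sup>2 + cmod (H 0 (x\<^sup>2) / x\<^sup>2 - c)" .
      qed
    qed
  qed
  moreover have "(deriv ^^ 2) \<phi> 0 = (deriv ^^ 2) (\<lambda>x. g x - K (s 1 * x)) 0 - (deriv ^^ 2) (\<lambda>x. c * x\<^sup>2) 0"
    unfolding \<phi>_def using R
    by (intro higher_deriv_diff[where S = "ball 0 R"] holomorphic_on_diff hols) auto
  moreover have "(deriv ^^ 2) (\<lambda>x. g x - K (s 1 * x)) 0 = (deriv ^^ 2) g 0 - (deriv ^^ 2) (\<lambda>x. K (s 1 * x)) 0"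
    using R by (intro higher_deriv_diff[where S = "ball 0 R"] hols) auto
  moreover have "(deriv ^^ 2) (\<lambda>x. K (s 1 * x)) 0 = (s 1)\<^sup>2 * (deriv ^^ 2) K (s 1 * 0)"
    by (rule higher_deriv_compose_linear[OF K_hol, where S = "ball 0 R"]) (use s1R R in auto)
  moreover have "(deriv ^^ 2) (\<lambda>x. c * x\<^sup>2) 0 = 2 * c"
  proof -
    have "deriv (\<lambda>x. c * x\<^sup>2) = (\<lambda>x. 2 * c * x)"
      by (rule ext, rule DERIV_imp_deriv) (auto intro!: derivative_eq_intros)
    then show ?thesis
      by (simp add: numeral_2_eq_2)
  qed
  \<comment> \<open>The vanishing second derivative of \<phi> identifies the second Taylor
    coefficient of \<open>g\<close>; the inner scaling of \<open>K\<close> by \<open>s 1\<close>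
    supplies the factor \<open>(s 1)\<^sup>2\<close>.\<close>
  ultimately have eq: "(deriv ^^ 2) g 0 / 2 = (deriv ^^ 2) K 0 / 2 * (s 1)\<^sup>2 + c"
    by (simp add: field_simps)
  have "cmod ((deriv ^^ 2) g 0) \<le> 2"
  proof (rule second_deriv_bound[OF g_hol])
    fix x :: complex assume "cmod x < 1"
    then show "cmod (g x) \<le> 1"
      unfolding g_def by (intro less_imp_le bd g_in) auto
  qed
  then have "cmod ((deriv ^^ 2) g 0 / 2) \<le> 1"
    by (simp add: norm_divide)
  then show ?thesis
    unfolding eq K_def s_def c_def .
qed

section \<open>The extremal problem for the two coefficients\<close>

text \<open>At \<open>\<alpha> = (n\<^sup>2 + 1) / (n (n\<^sup>2 - 1))\<close> the second hypothesis forces \<open>b \<le> -2 / (n\<^sup>2 - 1)\<close>, and then the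
  left-hand side of the first one is at least \<open>1 + 1 / n\<^sup>2\<close>.\<close>

lemma extremal_coefficient_real:
  fixes n \<alpha> b :: real
  assumes n: "n \<ge> 3" and circle: "(\<alpha> + n * b)\<^sup>2 + ((n\<^sup>2 - 1) / 2 * b)\<^sup>2 \<le> 1" and le: "n * \<alpha> + b \<le> 1"
  shows "\<alpha> \<le> (n\<^sup>2 + 1) / (n * (n\<^sup>2 - 1)) - 1 / (4 * n ^ 3 * (n\<^sup>2 - 1))"
proof (rule ccontr)
  define N where "N = n\<^sup>2 - 1"
  \<comment> \<open>The claimed bound multiplied by \<open>n * N\<close> is
    \<open>n\<^sup>2 + 1 - \<delta>\<close>, so \<delta> measures the distance to the critical
    value.\<close>
  define \<delta> where "\<delta> = 1 / (4 * n\<^sup>2)"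
  have N: "N > 0"
    using n by (simp add: N_def)
  have \<delta>: "0 < \<delta>" "\<delta> < 1/4" "\<delta> * n\<^sup>2 = 1/4"
    using n one_less_power[of n 2] by (auto simp: \<delta>_def field_simps)
  assume "\<not> ?thesis"
  moreover have "n * N * ((n\<^sup>2 + 1) / (n * N) - 1 / (4 * n ^ 3 * N)) = n\<^sup>2 + 1 - \<delta>"
    using n N by (simp add: \<delta>_def field_simps power2_eq_square power3_eq_cube)
  moreover have "0 < n * N"
    using n N by simp
  ultimately have \<alpha>: "n\<^sup>2 + 1 - \<delta> < n * N * \<alpha>"
    by (metis N_def linorder_not_le mult_strict_left_mono)
  have "n\<^sup>2 + 1 - \<delta> + N * b < n * N * \<alpha> + N * b"
    using \<alpha> by simp
  also have "\<dots> = N * (n * \<alpha> + b)"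
    by (simp add: algebra_simps)
  also have "\<dots> \<le> N * 1"
    using N le by (intro mult_left_mono) auto
  finally have Nb: "2 - \<delta> < - (N * b)"
    by (simp add: N_def)
  have "1 - \<delta> < n * (- (\<alpha> + n * b))"
  proof -
    have "n\<^sup>2 * (n * \<alpha> + b) \<le> n\<^sup>2 * 1"
      using le by (intro mult_left_mono) auto
    moreover have "n * (- (\<alpha> + n * b)) = n * N * \<alpha> - n\<^sup>2 * (n * \<alpha> + b)"
      by (simp add: N_def power2_eq_square algebra_simps)
    ultimately show ?thesis
      using \<alpha> by simp
  qed
  then have "(1 - \<delta>)\<^sup>2 < (n * (- (\<alpha> + n * b)))\<^sup>2"
    using \<delta> by (intro power_strict_mono) auto
  then have 1: "(1 - \<delta>)\<^sup>2 < n\<^sup>2 * (\<alpha> + n * b)\<^sup>2"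
    by (simp add: power_mult_distrib power2_commute power2_eq_square algebra_simps)
  have "(1 - \<delta> / 2)\<^sup>2 < (- (N * b) / 2)\<^sup>2"
    using \<delta> Nb by (intro power_strict_mono) auto
  then have "(1 - \<delta> / 2)\<^sup>2 < (N / 2 * b)\<^sup>2"
    by (simp add: power_divide power_mult_distrib)
  then have 2: "n\<^sup>2 * (1 - \<delta> / 2)\<^sup>2 < n\<^sup>2 * (N / 2 * b)\<^sup>2"
    using n by simp
  have "(1 - \<delta>)\<^sup>2 + n\<^sup>2 * (1 - \<delta> / 2)\<^sup>2 < n\<^sup>2 * ((\<alpha> + n * b)\<^sup>2 + (N / 2 * b)\<^sup>2)"
    using 1 2 by (simp add: distrib_left)
  also have "\<dots> \<le> n\<^sup>2 * 1"
    using circle by (intro mult_left_mono) (auto simp: N_def)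
  finally have "(1 - \<delta>)\<^sup>2 + n\<^sup>2 * (1 - \<delta> / 2)\<^sup>2 < n\<^sup>2"
    by simp
  \<comment> \<open>Using \<open>\<delta> * n\<^sup>2 = 1/4\<close>, the left-hand side above
    becomes \<open>n\<^sup>2 + 3/4 - 31/16 * \<delta> + \<delta>\<^sup>2\<close>, which exceeds
    \<open>n\<^sup>2\<close> because \<open>\<delta> < 1/4\<close>.\<close>
  moreover have "n\<^sup>2 * (1 - \<delta> / 2)\<^sup>2 = n\<^sup>2 - \<delta> * n\<^sup>2 + \<delta> * (\<delta> * n\<^sup>2) / 4"
    by (simp add: power2_eq_square algebra_simps)
  moreover have "(1 - \<delta>)\<^sup>2 = 1 - 2 * \<delta> + \<delta>\<^sup>2"
    by (simp add: power2_eq_square algebra_simps)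
  ultimately show False
    using \<delta> zero_le_power2[of \<delta>] unfolding \<delta>(3) by linarith
qed

lemma extremal_coefficient:
  fixes \<alpha> \<beta> :: complex and n :: real
  assumes n: "n \<ge> 3" and q: "cmod (of_real n * \<alpha> + \<beta>) \<le> 1"
    and q_i: "cmod (\<alpha> + \<beta> * (of_real n - \<i> * of_real ((n\<^sup>2 - 1) / 2))) \<le> 1"
    and q_mi: "cmod (\<alpha> + \<beta> * (of_real n + \<i> * of_real ((n\<^sup>2 - 1) / 2))) \<le> 1"
  shows "cmod \<alpha> \<le> (n\<^sup>2 + 1) / (n * (n\<^sup>2 - 1)) - 1 / (4 * n ^ 3 * (n\<^sup>2 - 1))"
proof -
  obtain \<omega> where \<omega>: "cmod \<omega> = 1" "\<omega> * \<alpha> = of_real (cmod \<alpha>)"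
  proof (cases "\<alpha> = 0")
    case True
    then show ?thesis by (intro that[of 1]) auto
  next
    case False
    have "\<alpha> * cnj \<alpha> = of_real (cmod \<alpha>) * of_real (cmod \<alpha>)"
      using complex_norm_square[of \<alpha>] by (simp add: power2_eq_square)
    with False show ?thesis
      by (intro that[of "cnj \<alpha> / of_real (cmod \<alpha>)"]) (auto simp: norm_divide mult.commute)
  qed
  define M where "M = (n\<^sup>2 - 1) / 2"
  define a where "a = cmod \<alpha>"
  define b b' where "b = Re (\<omega> * \<beta>)" and "b' = Im (\<omega> * \<beta>)"
  have \<beta>: "\<omega> * \<beta> = Complex b b'"
    by (simp add: b_def b'_def complex_eq_iff)
  have *: "cmod (of_real a + \<omega> * \<beta> * v) \<le> 1" if "cmod (\<alpha> + \<beta> * v) \<le> 1" for v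
  proof -
    have "of_real a + \<omega> * \<beta> * v = \<omega> * (\<alpha> + \<beta> * v)"
      using \<omega>(2) by (simp add: a_def algebra_simps)
    then show ?thesis
      using that \<omega>(1) by (simp add: norm_mult)
  qed
  have "(a + n * b + M * b')\<^sup>2 + (n * b' - M * b)\<^sup>2 \<le> 1"
    using *[OF q_i] unfolding \<beta> M_def[symmetric] by (simp add: cmod_def algebra_simps)
  moreover have "(a + n * b - M * b')\<^sup>2 + (n * b' + M * b)\<^sup>2 \<le> 1"
    using *[OF q_mi] unfolding \<beta> M_def[symmetric] by (simp add: cmod_def algebra_simps)
  moreover have "(a + n * b + M * b')\<^sup>2 + (n * b' - M * b)\<^sup>2 + ((a + n * b - M * b')\<^sup>2 + (n * b' + M * b)\<^sup>2)
      = 2 * ((a + n * b)\<^sup>2 + (M * b)\<^sup>2) + 2 * ((M * b')\<^sup>2 + (n * b')\<^sup>2)"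
    by (simp add: power2_eq_square algebra_simps)
  ultimately have "2 * ((a + n * b)\<^sup>2 + (M * b)\<^sup>2) + 2 * ((M * b')\<^sup>2 + (n * b')\<^sup>2) \<le> 1 + 1"
    by (metis add_mono)
  moreover have "u \<le> 1" if "2 * u + 2 * e \<le> 1 + 1" "0 \<le> e" for u e :: real
    using that by linarith
  ultimately have circle: "(a + n * b)\<^sup>2 + (M * b)\<^sup>2 \<le> 1"
    using sum_power2_ge_zero by blast
  have "cmod (of_real n * of_real a + \<omega> * \<beta>) \<le> 1"
  proof -
    have "of_real n * of_real a + \<omega> * \<beta> = \<omega> * (of_real n * \<alpha> + \<beta>)"
      using \<omega>(2) by (simp add: a_def algebra_simps)
    then show ?thesis
      using q \<omega>(1) by (simp add: norm_mult)
  qed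
  then have "n * a + b \<le> 1"
    unfolding \<beta> using complex_Re_le_cmod[of "of_real n * of_real a + Complex b b'"] by simp
  with circle show ?thesis
    unfolding a_def M_def by (intro extremal_coefficient_real[OF n])
qed

text \<open>By Newton's identity the form is \<alpha> times the sum of squares plus \<beta> times
  the square of the sum, with \<open>\<alpha> = - c / 2\<close>, so bounding \<open>c\<close> means
  bounding \<alpha>.\<close>

lemma second_coefficient_bound:
  fixes c \<kappa> :: complex
  assumes odd: "odd CARD('n::{finite,linorder})" and n3: "CARD('n) \<ge> 3"
    and bd: "\<And>z :: complex ^ 'n::{finite,linorder}. (\<And>i. cmod (z $ i) \<le> 1) \<Longrightarrow>
      cmod (\<kappa> * (elem_sym 1 z)\<^sup>2 + c * elem_sym 2 z) \<le> 1"
  defines "n \<equiv> real CARD('n)"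
  shows "cmod c \<le> 2 * ((n\<^sup>2 + 1) / (n * (n\<^sup>2 - 1)) - 1 / (4 * n ^ 3 * (n\<^sup>2 - 1)))"
proof -
  obtain m where m: "CARD('n) = 2 * m + 1"
    using odd by (elim oddE)
  define \<alpha> \<beta> where "\<alpha> = - c / 2" and "\<beta> = \<kappa> + c / 2"
  define M where "M = (of_nat m :: complex)"
  have q: "cmod (\<alpha> * (M + 1 + M * u\<^sup>2) + \<beta> * (M + 1 - M * u)\<^sup>2) \<le> 1" if u: "cmod u = 1" for u
  proof -
    define z :: "complex ^ 'n::{finite,linorder}" where "z = (\<chi> i. if coord_index i \<le> m + 1 then 1 else - u)"
    have sum: "(\<Sum>i\<in>(UNIV :: 'n set). if coord_index i \<le> m + 1 then a else b) = (M + 1) * a + M * b" for a b :: complex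
    proof -
      have "{1..CARD('n)} \<inter> {k. k \<le> m + 1} = {1..m + 1}" "{1..CARD('n)} \<inter> - {k. k \<le> m + 1} = {m + 2..2 * m + 1}"
        using m by auto
      then show ?thesis
        by (subst sum_UNIV_coord_index) (simp add: sum.If_cases M_def)
    qed
    have 1: "elem_sym 1 z = M + 1 - M * u"
      using sum[of 1 "- u"] by (simp add: elem_sym_Suc_0 z_def)
    have 2: "(\<Sum>i\<in>UNIV. (z $ i)\<^sup>2) = M + 1 + M * u\<^sup>2"
      using sum[of 1 "u\<^sup>2"] by (simp add: z_def if_distrib[of "\<lambda>x. x\<^sup>2"] cong: if_cong)
    have 3: "elem_sym 2 z = ((elem_sym 1 z)\<^sup>2 - (\<Sum>i\<in>UNIV. (z $ i)\<^sup>2)) / 2"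
      using elem_sym_2[of z] by (simp add: elem_sym_Suc_0 field_simps)
    have "\<kappa> * (elem_sym 1 z)\<^sup>2 + c * elem_sym 2 z =
        \<alpha> * (M + 1 + M * u\<^sup>2) + \<beta> * (M + 1 - M * u)\<^sup>2"
      unfolding 3 unfolding 1 2 \<alpha>_def \<beta>_def by (simp add: field_simps)
    then show ?thesis
      using bd[of z] u by (simp add: z_def)
  qed
  have n: "n = 2 * real m + 1" "n \<ge> 3"
    using m n3 by (auto simp: n_def)
  have nM: "of_real n = 2 * M + 1" "of_real ((n\<^sup>2 - 1) / 2) = 2 * M * (M + 1)"
    by (simp_all add: n M_def power2_eq_square field_simps)
  have "cmod \<alpha> \<le> (n\<^sup>2 + 1) / (n * (n\<^sup>2 - 1)) - 1 / (4 * n ^ 3 * (n\<^sup>2 - 1))"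
  proof (rule extremal_coefficient[OF n(2)])
    show "cmod (of_real n * \<alpha> + \<beta>) \<le> 1"
      using q[of 1] unfolding nM by (simp add: algebra_simps)
    \<comment> \<open>For \<open>u = \<i>\<close> and \<open>u = - \<i>\<close> the sum of squares
      is only 1, while the square of the sum has real part \<open>n\<close> and imaginary part of
      modulus \<open>(n\<^sup>2 - 1) / 2\<close>.\<close>
    have "(M + 1 - M * \<i>)\<^sup>2 = 2 * M + 1 - \<i> * (2 * M * (M + 1))" "(M + 1 + M * \<i>)\<^sup>2 = 2 * M + 1 + \<i> * (2 * M * (M + 1))"
      by (simp_all add: power2_eq_square algebra_simps)
    then show "cmod (\<alpha> + \<beta> * (of_real n - \<i> * of_real ((n\<^sup>2 - 1) / 2))) \<le> 1"
      "cmod (\<alpha> + \<beta> * (of_real n + \<i> * of_real ((n\<^sup>2 - 1) / 2))) \<le> 1"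
      using q[of \<i>] q[of "- \<i>"] unfolding nM by simp_all
  qed
  moreover have "cmod c = 2 * cmod \<alpha>"
    by (simp add: \<alpha>_def norm_divide)
  ultimately show ?thesis
    by (metis mult_left_mono zero_le_numeral)
qed

section \<open>The lower bound\<close>

text \<open>The left-hand side is affine in each \<open>x\<^sub>i\<close>, so it suffices to look at signs, where the sum is an
  odd integer.\<close>

lemma odd_sum_square_bound:
  fixes x :: "'a \<Rightarrow> real" and a :: int
  assumes "finite A" and "\<And>i. i \<in> A \<Longrightarrow> \<bar>x i\<bar> \<le> 1" and "odd (a + int (card A))"
  shows "1 \<le> (of_int a + (\<Sum>i\<in>A. x i))\<^sup>2 + (\<Sum>i\<in>A. 1 - (x i)\<^sup>2)"
  using assms
proof (induction A arbitrary: a rule: finite_induct)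
  case empty
  then have "a \<noteq> 0"
    by auto
  then have "1 \<le> a\<^sup>2"
    by (simp add: int_one_le_iff_zero_less)
  then have "1 \<le> (of_int a :: real)\<^sup>2"
    by (metis of_int_1_le_iff of_int_power)
  then show ?case by simp
next
  case (insert j A)
  define S where "S = (\<Sum>i\<in>A. x i)"
  define T where "T = (\<Sum>i\<in>A. 1 - (x i)\<^sup>2)"
  define X where "X = x j"
  \<comment> \<open>Setting \<open>x j\<close> to 1 or -1 absorbs it into the integer
    \<open>a\<close> and kills its term in the second sum; the parity condition passes to
    \<open>A\<close>. The general \<open>x j\<close> is the average of these signs with weights
    \<open>(1 + X) / 2\<close> and \<open>(1 - X) / 2\<close>.\<close>
  have 1: "1 \<le> (of_int a + 1 + S)\<^sup>2 + T"
    using insert.IH[of "a + 1"] insert.prems insert.hyps by (simp add: S_def T_def)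
  have 2: "1 \<le> (of_int a - 1 + S)\<^sup>2 + T"
    using insert.IH[of "a - 1"] insert.prems insert.hyps by (simp add: S_def T_def)
  have X: "0 \<le> (1 + X) / 2" "0 \<le> (1 - X) / 2"
    using insert.prems(1)[of j] by (auto simp: X_def abs_le_iff)
  have "1 = (1 + X) / 2 * 1 + (1 - X) / 2 * 1"
    by (simp add: field_simps)
  also have "\<dots> \<le> (1 + X) / 2 * ((of_int a + 1 + S)\<^sup>2 + T) + (1 - X) / 2 * ((of_int a - 1 + S)\<^sup>2 + T)"
    using X 1 2 by (intro add_mono mult_left_mono) auto
  also have "\<dots> = (of_int a + (X + S))\<^sup>2 + (1 - X\<^sup>2 + T)"
    by (simp add: power2_eq_square field_simps)
  finally show ?case
    using insert.hyps by (simp add: S_def T_def X_def)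
qed

section \<open>The maximum of the real quadratic form and its equality case\<close>

text \<open>Variance identity: it shows the Cauchy-Schwarz defect of the \<open>y j\<close> as a sum
  of squares, which vanishes only if all \<open>y j\<close> agree.\<close>

lemma sum_square_deviation:
  fixes y :: "'n::finite \<Rightarrow> real"
  shows "(\<Sum>j\<in>UNIV. (real CARD('n) * y j - (\<Sum>i\<in>UNIV. y i))\<^sup>2)
    = real CARD('n) * (real CARD('n) * (\<Sum>j\<in>UNIV. (y j)\<^sup>2) - (\<Sum>i\<in>UNIV. y i)\<^sup>2)"
proof -
  define Y where "Y = (\<Sum>i\<in>UNIV. y i)"
  define n where "n = real CARD('n)"
  have "(\<Sum>j\<in>UNIV. (n * y j - Y)\<^sup>2) = (\<Sum>j\<in>UNIV. n\<^sup>2 * (y j)\<^sup>2 - 2 * n * Y * y j + Y\<^sup>2)"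
    by (simp add: power2_eq_square algebra_simps)
  also have "\<dots> = n\<^sup>2 * (\<Sum>j\<in>UNIV. (y j)\<^sup>2) - 2 * n * Y * Y + n * Y\<^sup>2"
    by (simp add: sum.distrib sum_subtractf flip: sum_distrib_left n_def Y_def)
  finally show ?thesis
    by (simp add: power2_eq_square algebra_simps flip: n_def Y_def)
qed

text \<open>Here \<open>x\<close> and \<open>y\<close> are the real and imaginary parts of a point
  of the closed polydisc. The value of \<open>t\<close> is the one with
  \<open>(n + 1) / 2 * t = 1\<close>, which gives \<open>X\<^sup>2\<close> and
  \<open>Y\<^sup>2\<close> the coefficients needed in the decomposition below.\<close>

context
  fixes x y :: "'n::finite \<Rightarrow> real" and n X Y t :: real
  assumes odd: "odd CARD('n)" and n3: "CARD('n) \<ge> 3"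
    and disc: "\<And>j. (x j)\<^sup>2 + (y j)\<^sup>2 \<le> 1"
  defines "n \<equiv> real CARD('n)" and "X \<equiv> \<Sum>j\<in>UNIV. x j" and "Y \<equiv> \<Sum>j\<in>UNIV. y j" and "t \<equiv> 2 / (n + 1)"
begin

lemma abs_x_le_1: "\<bar>x j\<bar> \<le> 1"
proof -
  have "(x j)\<^sup>2 \<le> 1"
    using disc[of j] by (smt (verit) zero_le_power2)
  then show ?thesis
    by (simp add: abs_square_le_1)
qed

text \<open>The gap to the claimed maximum splits into three nonnegative terms: one from the parity
  inequality for \<open>x\<close>, one from the disc constraints, one from the variance of
  \<open>y\<close>.\<close>

lemma quadratic_form_decomposition:
  "(n + 1) / 2 * (n - t - ((\<Sum>j\<in>UNIV. (x j)\<^sup>2 - (y j)\<^sup>2) - t * (X\<^sup>2 - Y\<^sup>2))) =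
    (X\<^sup>2 + (\<Sum>j\<in>UNIV. 1 - (x j)\<^sup>2) - 1) + (n - 1) / 2 * (\<Sum>j\<in>UNIV. 1 - (x j)\<^sup>2 - (y j)\<^sup>2)
    + (\<Sum>j\<in>UNIV. (n * y j - Y)\<^sup>2) / n"
proof -
  have n: "n \<ge> 3"
    using n3 by (simp add: n_def)
  define P where "P = (\<Sum>j\<in>UNIV. (x j)\<^sup>2)"
  define Q where "Q = (\<Sum>j\<in>UNIV. (y j)\<^sup>2)"
  have "(\<Sum>j\<in>UNIV. (n * y j - Y)\<^sup>2) / n = n * Q - Y\<^sup>2"
    using n unfolding n_def Y_def sum_square_deviation by (simp add: Q_def)
  moreover have "(\<Sum>j\<in>UNIV. 1 - (x j)\<^sup>2) = n - P" "(\<Sum>j\<in>UNIV. 1 - (x j)\<^sup>2 - (y j)\<^sup>2) = n - P - Q"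
    "(\<Sum>j\<in>UNIV. (x j)\<^sup>2 - (y j)\<^sup>2) = P - Q"
    by (simp_all add: sum_subtractf n_def P_def Q_def)
  moreover have "(n + 1) / 2 * (n - t - ((P - Q) - t * (X\<^sup>2 - Y\<^sup>2))) =
      (X\<^sup>2 + (n - P) - 1) + (n - 1) / 2 * (n - P - Q) + (n * Q - Y\<^sup>2)"
  proof -
    have "(n + 1) / 2 * (n - t - ((P - Q) - t * (X\<^sup>2 - Y\<^sup>2))) =
        (n + 1) / 2 * (n - (P - Q)) - ((n + 1) / 2 * t) * (1 - (X\<^sup>2 - Y\<^sup>2))"
      by (simp add: field_simps)
    also have "(n + 1) / 2 * t = 1"
      using n by (simp add: t_def)
    finally show ?thesis
      by (simp add: field_simps)
  qed
  ultimately show ?thesis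
    by simp
qed

lemma quadratic_form_summands_nonneg:
  shows "0 \<le> X\<^sup>2 + (\<Sum>j\<in>UNIV. 1 - (x j)\<^sup>2) - 1" "0 \<le> (\<Sum>j\<in>UNIV. 1 - (x j)\<^sup>2 - (y j)\<^sup>2)"
    "0 \<le> (\<Sum>j\<in>UNIV. (n * y j - Y)\<^sup>2)"
proof -
  show "0 \<le> X\<^sup>2 + (\<Sum>j\<in>UNIV. 1 - (x j)\<^sup>2) - 1"
    using odd_sum_square_bound[of UNIV x 0] abs_x_le_1 odd by (simp add: X_def)
  show "0 \<le> (\<Sum>j\<in>UNIV. 1 - (x j)\<^sup>2 - (y j)\<^sup>2)"
    using disc by (intro sum_nonneg) (smt (verit))
qed (auto intro: sum_nonneg)

lemma quadratic_form_le: "(\<Sum>j\<in>UNIV. (x j)\<^sup>2 - (y j)\<^sup>2) - t * (X\<^sup>2 - Y\<^sup>2) \<le> n - t"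
proof -
  have n: "n \<ge> 3"
    using n3 by (simp add: n_def)
  have "0 \<le> (n + 1) / 2 * (n - t - ((\<Sum>j\<in>UNIV. (x j)\<^sup>2 - (y j)\<^sup>2) - t * (X\<^sup>2 - Y\<^sup>2)))"
    unfolding quadratic_form_decomposition using quadratic_form_summands_nonneg n
    by (intro add_nonneg_nonneg mult_nonneg_nonneg divide_nonneg_nonneg) auto
  then show ?thesis
    using n by (simp add: zero_le_mult_iff)
qed

text \<open>Equality annihilates all three terms: the \<open>y j\<close> agree and the
  \<open>x j\<close> agree up to sign, with common modulus \<open>r\<close>. An odd number of signs
  cannot cancel, so \<open>r\<^sup>2 \<le> X\<^sup>2\<close>; this forces
  \<open>r\<^sup>2 = 1\<close>, hence \<open>Y = 0\<close> and \<open>X\<^sup>2 = 1\<close>.\<close>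

lemma quadratic_form_eqD:
  assumes eq: "(\<Sum>j\<in>UNIV. (x j)\<^sup>2 - (y j)\<^sup>2) - t * (X\<^sup>2 - Y\<^sup>2) = n - t"
  shows "X\<^sup>2 - Y\<^sup>2 = 1"
proof -
  have n: "n \<ge> 3"
    using n3 by (simp add: n_def)
  define A where "A = X\<^sup>2 + (\<Sum>j\<in>UNIV. 1 - (x j)\<^sup>2) - 1"
  define B where "B = (\<Sum>j\<in>UNIV. 1 - (x j)\<^sup>2 - (y j)\<^sup>2)"
  define C where "C = (\<Sum>j\<in>UNIV. (n * y j - Y)\<^sup>2)"
  have nonneg: "0 \<le> A" "0 \<le> B" "0 \<le> C"
    using quadratic_form_summands_nonneg by (auto simp: A_def B_def C_def)
  have "A + (n - 1) / 2 * B + C / n = 0"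
    using quadratic_form_decomposition eq by (simp add: A_def B_def C_def)
  moreover have "0 \<le> (n - 1) / 2 * B" "0 \<le> C / n"
    using nonneg n by auto
  ultimately have "A = 0" "(n - 1) / 2 * B = 0" "C / n = 0"
    using nonneg(1) by linarith+
  then have zero: "A = 0" "B = 0" "C = 0"
    using n by auto
  have y: "y j = Y / n" for j
    using zero(3) n sum_nonneg_eq_0_iff[of UNIV "\<lambda>j. (n * y j - Y)\<^sup>2"] by (simp add: C_def field_simps)
  define r where "r = sqrt (1 - (Y / n)\<^sup>2)"
  have xy: "(x j)\<^sup>2 = 1 - (Y / n)\<^sup>2" for j
    using zero(2) disc y sum_nonneg_eq_0_iff[of UNIV "\<lambda>j. 1 - (x j)\<^sup>2 - (y j)\<^sup>2"]
    by (simp add: B_def algebra_simps)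
  then have r: "r\<^sup>2 = 1 - (Y / n)\<^sup>2"
    unfolding r_def by (metis real_sqrt_pow2 zero_le_power2)
  with xy have x: "(x j)\<^sup>2 = r\<^sup>2" for j
    by simp
  have X: "X\<^sup>2 = 1 - n * (1 - r\<^sup>2)"
    using zero(1) by (simp add: A_def x n_def)
  have "r\<^sup>2 \<le> X\<^sup>2"
  proof (cases "r = 0")
    case False
    have "(x j / r)\<^sup>2 = 1" for j
      using x False by (simp add: power_divide)
    moreover from this have "\<bar>x j / r\<bar> \<le> 1" for j
      by (metis abs_square_le_1 order_refl)
    ultimately have "1 \<le> (\<Sum>j\<in>UNIV. x j / r)\<^sup>2"
      using odd_sum_square_bound[of UNIV "\<lambda>j. x j / r" 0] odd by simp
    also have "(\<Sum>j\<in>UNIV. x j / r) = X / r"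
      by (simp add: X_def sum_divide_distrib)
    finally show ?thesis
      using False by (simp add: power_divide field_simps)
  qed auto
  then have "(n - 1) * (1 - r\<^sup>2) \<le> 0"
    unfolding X by (simp add: algebra_simps)
  moreover have "r\<^sup>2 \<le> 1"
    by (simp add: r)
  ultimately have "r\<^sup>2 = 1"
    using n by (simp add: mult_le_0_iff)
  then show ?thesis
    using r X n by simp
qed

end

text \<open>Where equality holds in \<open>quadratic_form_le\<close>, the real part of \<open>(\<Sum>z)\<^sup>2\<close> is \<open>1\<close>; so by compactness a
  slightly larger \<open>t\<close> gives a strictly better bound.\<close>

lemma improved_form_bound:
  assumes odd: "odd CARD('n::finite)" and n3: "CARD('n) \<ge> 3"
  defines "n \<equiv> real CARD('n)"
  shows "\<exists>M t :: real. 0 \<le> M \<and> M < n - 2 / (n + 1) \<and> (\<forall>z :: complex ^ 'n. (\<forall>i. cmod (z $ i) \<le> 1) \<longrightarrow>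
      cmod ((\<Sum>i\<in>UNIV. (z $ i)\<^sup>2) - of_real t * (\<Sum>i\<in>UNIV. z $ i)\<^sup>2) \<le> M)"
proof -
  define t where "t = 2 / (n + 1)"
  define p where "p z = Re (\<Sum>i\<in>UNIV. (z $ i)\<^sup>2)" for z :: "complex ^ 'n"
  define s where "s z = Re ((\<Sum>i\<in>UNIV. z $ i)\<^sup>2)" for z :: "complex ^ 'n"
  define D where "D = {z :: complex ^ 'n. \<forall>i. cmod (z $ i) \<le> 1}"
  have n: "n \<ge> 3"
    using n3 by (simp add: n_def)
  have p_eq: "p z = (\<Sum>j\<in>UNIV. (Re (z $ j))\<^sup>2 - (Im (z $ j))\<^sup>2)" for z
    by (simp add: p_def power2_eq_square)
  have s_eq: "s z = (\<Sum>j\<in>UNIV. Re (z $ j))\<^sup>2 - (\<Sum>j\<in>UNIV. Im (z $ j))\<^sup>2" for z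
    by (simp add: s_def power2_eq_square)
  have disc: "(Re (z $ j))\<^sup>2 + (Im (z $ j))\<^sup>2 \<le> 1" if "z \<in> D" for z j
    using that by (simp add: D_def cmod_def)
  have le: "p z - t * s z \<le> n - t" if "z \<in> D" for z
    using quadratic_form_le[OF odd n3 disc[OF that]] by (simp add: p_eq s_eq t_def n_def)
  have eqD: "s z = 1" if "z \<in> D" "p z - t * s z = n - t" for z
    using quadratic_form_eqD[OF odd n3 disc[OF that(1)]] that(2) by (simp add: p_eq s_eq t_def n_def)
  have s_ge: "- s z \<le> n\<^sup>2" if "z \<in> D" for z
  proof -
    have "cmod (\<Sum>i\<in>UNIV. z $ i) \<le> (\<Sum>i\<in>(UNIV :: 'n set). 1)"
      using that by (intro sum_norm_le) (auto simp: D_def)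
    then have "cmod ((\<Sum>i\<in>UNIV. z $ i)\<^sup>2) \<le> n\<^sup>2"
      by (simp add: norm_power n_def power_mono)
    then show ?thesis
      using abs_Re_le_cmod[of "(\<Sum>i\<in>UNIV. z $ i)\<^sup>2"] by (simp add: s_def)
  qed
  have cont: "continuous_on UNIV p" "continuous_on UNIV s"
    unfolding p_def s_def by (intro continuous_intros)+
  have D_eq: "D = (\<Inter>i. {z. cmod (z $ i) \<le> 1})"
    by (auto simp: D_def)
  have "bounded D"
  proof (rule boundedI)
    fix z assume "z \<in> D"
    then have "(\<Sum>i\<in>UNIV. cmod (z $ i)) \<le> (\<Sum>i\<in>(UNIV :: 'n set). 1)"
      by (intro sum_mono) (auto simp: D_def)
    then show "norm z \<le> n"
      using L2_set_le_sum[of UNIV "\<lambda>i. cmod (z $ i)"] by (simp add: n_def norm_vec_def)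
  qed
  moreover have "closed D"
    unfolding D_eq by (intro closed_INT ballI closed_Collect_le continuous_intros)
  ultimately have compact_D: "compact D"
    by (simp add: compact_eq_bounded_closed)
  \<comment> \<open>Equality in \<open>le\<close> forces \<open>s z = 1\<close>, so it never occurs
    on this compact set and the gap \<delta> there is positive.\<close>
  define A where "A = D \<inter> {z. s z \<le> 1 / 2}"
  have "compact A"
    unfolding A_def by (intro compact_Int_closed compact_D closed_Collect_le cont continuous_intros)
  have "0 \<in> A"
    by (simp add: A_def D_def s_def)
  have "continuous_on A (\<lambda>z. p z - t * s z)"
    by (intro continuous_intros continuous_on_subset[OF cont(1)] continuous_on_subset[OF cont(2)] subset_UNIV)
  then obtain z0 where z0: "z0 \<in> A" "\<And>z. z \<in> A \<Longrightarrow> p z - t * s z \<le> p z0 - t * s z0"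
    using continuous_attains_sup[OF \<open>compact A\<close>] \<open>0 \<in> A\<close> by blast
  define \<delta> where "\<delta> = n - t - (p z0 - t * s z0)"
  have "\<delta> > 0"
    using z0(1) le[of z0] eqD[of z0] by (fastforce simp: \<delta>_def A_def)
  \<comment> \<open>Raising \<open>t\<close> by \<epsilon> costs at most \<open>\<delta> / 2\<close>
    on \<open>A\<close>, half of the gap, and gains at least \<open>\<epsilon> / 2\<close> on the
    rest of \<open>D\<close>, where \<open>s z > 1 / 2\<close>.\<close>
  define \<epsilon> where "\<epsilon> = \<delta> / (2 * n\<^sup>2)"
  have \<epsilon>: "\<epsilon> > 0" "\<epsilon> * n\<^sup>2 = \<delta> / 2"
    using n \<open>\<delta> > 0\<close> by (auto simp: \<epsilon>_def)
  define M where "M = n - t - min (\<delta> / 2) (\<epsilon> / 2)"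
  have re: "p z - (t + \<epsilon>) * s z \<le> M" if z: "z \<in> D" for z
  proof (cases "z \<in> A")
    case True
    have "\<epsilon> * (- s z) \<le> \<epsilon> * n\<^sup>2"
      using \<epsilon> s_ge[OF z] by (intro mult_left_mono) auto
    moreover have "p z - t * s z \<le> n - t - \<delta>"
      using z0(2)[OF True] by (simp add: \<delta>_def)
    ultimately show ?thesis
      unfolding M_def \<epsilon>(2) by (simp add: algebra_simps min_def)
  next
    case False
    then have "\<epsilon> * (1 / 2) \<le> \<epsilon> * s z"
      using \<epsilon> z by (intro mult_left_mono) (auto simp: A_def)
    then show ?thesis
      using le[OF z] unfolding M_def by (simp add: algebra_simps min_def)
  qed
  have bound: "cmod ((\<Sum>i\<in>UNIV. (z $ i)\<^sup>2) - of_real (t + \<epsilon>) * (\<Sum>i\<in>UNIV. z $ i)\<^sup>2) \<le> M"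
    if z: "\<And>i. cmod (z $ i) \<le> 1" for z :: "complex ^ 'n"
  proof -
    define F where "F w = (\<Sum>i\<in>UNIV. (w $ i)\<^sup>2) - of_real (t + \<epsilon>) * (\<Sum>i\<in>UNIV. w $ i)\<^sup>2" for w :: "complex ^ 'n"
    obtain \<omega> where \<omega>: "cmod \<omega> = 1" "\<omega>\<^sup>2 * F z = of_real (cmod (F z))"
    proof (cases "F z = 0")
      case True
      then show ?thesis by (intro that[of 1]) auto
    next
      case False
      \<comment> \<open>The form is homogeneous of degree two, so a square root of the phase rotates
        its value onto the nonnegative real axis.\<close>
      define \<omega> where "\<omega> = csqrt (cnj (F z) / of_real (cmod (F z)))"
      have sq: "\<omega>\<^sup>2 = cnj (F z) / of_real (cmod (F z))"
        by (simp add: \<omega>_def)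
      then have "(cmod \<omega>)\<^sup>2 = 1"
        using False by (simp add: norm_divide flip: norm_power)
      then have "cmod \<omega> = 1"
        by (simp add: power2_eq_1_iff) (smt (verit) norm_ge_zero)
      moreover have "F z * cnj (F z) = of_real (cmod (F z)) * of_real (cmod (F z))"
        using complex_norm_square[of "F z"] by (simp add: power2_eq_square)
      then have "\<omega>\<^sup>2 * F z = of_real (cmod (F z))"
        using False unfolding sq by (simp add: mult.commute)
      ultimately show ?thesis
        by (rule that)
    qed
    have "F (\<omega> *s z) = \<omega>\<^sup>2 * F z"
      by (simp add: F_def power_mult_distrib algebra_simps flip: sum_distrib_left)
    then have "cmod (F z) = Re (F (\<omega> *s z))"
      using \<omega>(2) by simp
    also have "\<dots> = p (\<omega> *s z) - (t + \<epsilon>) * s (\<omega> *s z)"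
      by (simp add: F_def p_def s_def)
    also have "\<dots> \<le> M"
      using z \<omega>(1) by (intro re) (auto simp: D_def norm_mult)
    finally show ?thesis
      by (simp add: F_def)
  qed
  show ?thesis
  proof (intro exI conjI allI impI)
    show "0 \<le> M"
      using re[of 0] by (simp add: D_def p_def s_def)
    show "M < n - 2 / (n + 1)"
      using \<open>\<delta> > 0\<close> \<epsilon>(1) by (simp add: M_def t_def)
  qed (rule bound, blast)
qed

section \<open>A quadratic competitor\<close>

lemma exists_large_derivative:
  assumes odd: "odd CARD('n::{finite,linorder})" and n3: "CARD('n) \<ge> 3"
  defines "n \<equiv> real CARD('n)"
  obtains f L where "f \<in> holomorphic_to_disc (symmetrized_disc :: (complex ^ 'n::{finite,linorder}) set)" "f 0 = 0"
    "(f has_derivative L) (at 0)" "2 / (n - 2 / (n + 1)) < cmod (L (std_basis 2))"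
proof -
  obtain M t :: real where M: "0 \<le> M" "M < n - 2 / (n + 1)"
    and bound: "\<And>z :: complex ^ 'n::{finite,linorder}. (\<And>i. cmod (z $ i) \<le> 1) \<Longrightarrow>
      cmod ((\<Sum>i\<in>UNIV. (z $ i)\<^sup>2) - of_real t * (\<Sum>i\<in>UNIV. z $ i)\<^sup>2) \<le> M"
    using improved_form_bound[OF odd n3] unfolding n_def by blast
  \<comment> \<open>\<open>M < M'\<close> keeps the competitor strictly inside the disc and makes
    \<open>M'\<close> positive even if \<open>M = 0\<close>; the upper estimate keeps its derivative
    strictly above the target.\<close>
  obtain M' where M': "M < M'" "M' < n - 2 / (n + 1)"
    using dense[OF M(2)] by blast
  define C where "C = 2 / M'"
  \<comment> \<open>By Newton's identity \<open>elem_sym 2 z - a * (elem_sym 1 z)\<^sup>2\<close> is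
    then -1/2 times the form bounded by \<open>M\<close>.\<close>
  define a where "a = (1 - t) / 2"
  have "1 \<in> {1..CARD('n)}" "2 \<in> {1..CARD('n)}"
    using n3 by auto
  then obtain i j :: 'n where ij: "coord_index i = 1" "coord_index j = 2"
    using bij_betw_imp_surj_on[OF bij_betw_coord_index] by (metis imageE)
  define f where "f w = of_real C * (w $ j - of_real a * (w $ i)\<^sup>2)" for w :: "complex ^ 'n::{finite,linorder}"
  define L where "L w v = of_real C * (v $ j - of_real a * (2 * w $ i * v $ i))" for w v :: "complex ^ 'n::{finite,linorder}"
  have der: "(f has_derivative L w) (at w)" for w
    unfolding f_def[abs_def] L_def[abs_def]
    by (auto intro!: derivative_eq_intros bounded_linear.has_derivative[OF bounded_linear_vec_nth] simp: algebra_simps)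
  have "cmod (f (symmetrization z)) < 1" if "z \<in> polydisc" for z
  proof -
    have e2: "elem_sym 2 z = ((elem_sym 1 z)\<^sup>2 - (\<Sum>i\<in>UNIV. (z $ i)\<^sup>2)) / 2"
      using elem_sym_2[of z] by (simp add: elem_sym_Suc_0 field_simps)
    have "f (symmetrization z) = of_real C * (elem_sym 2 z - of_real a * (elem_sym 1 z)\<^sup>2)"
      by (simp add: f_def symmetrization_def ij)
    also have "\<dots> = - (of_real C / 2) * ((\<Sum>i\<in>UNIV. (z $ i)\<^sup>2) - of_real t * (\<Sum>i\<in>UNIV. z $ i)\<^sup>2)"
      unfolding e2 by (simp add: a_def elem_sym_Suc_0 field_simps)
    finally have "cmod (f (symmetrization z)) = C / 2 * cmod ((\<Sum>i\<in>UNIV. (z $ i)\<^sup>2) - of_real t * (\<Sum>i\<in>UNIV. z $ i)\<^sup>2)"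
      using M M' by (simp add: norm_mult norm_divide C_def)
    also have "\<dots> \<le> C / 2 * M"
      using that M M' by (intro mult_left_mono bound) (auto simp: polydisc_def C_def less_imp_le)
    also have "\<dots> < 1"
      using M M' by (simp add: C_def)
    finally show ?thesis .
  qed
  moreover have "holomorphic_several f symmetrized_disc"
    unfolding holomorphic_several_def using der
    by (intro ballI exI[of _ "L _"] conjI) (auto simp: L_def algebra_simps)
  ultimately have "f \<in> holomorphic_to_disc symmetrized_disc"
    by (auto simp: holomorphic_to_disc_def symmetrized_disc_def)
  moreover have "cmod (L 0 (std_basis 2)) = C"
    using M M' by (simp add: L_def std_basis_def ij C_def norm_divide)
  moreover have "2 / (n - 2 / (n + 1)) < C"
    unfolding C_def using M M' by (intro divide_strict_left_mono) auto
  ultimately show ?thesis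
    using that[of f "L 0"] der[of 0] by (simp add: f_def)
qed

section \<open>Comparison of the supremum with both bounds\<close>

theorem proposition4:
  fixes n :: nat
  assumes "n = CARD('n::{finite,linorder})" and "n \<ge> 3" and "odd n"
  shows "2 / real n * (1 + 2 / ((real n - 1) * (real n + 2)))
           < caratheodory_reiffen (symmetrized_disc :: (complex ^ 'n::{finite,linorder}) set) 0 (std_basis 2)
       \<and> caratheodory_reiffen (symmetrized_disc :: (complex ^ 'n::{finite,linorder}) set) 0 (std_basis 2)
           < 2 / real n * (1 + 2 / ((real n - 1) * (real n + 1)))"
proof -
  let ?G = "symmetrized_disc :: (complex ^ 'n::{finite,linorder}) set"
  let ?S = "{cmod (frechet_derivative f (at 0) (std_basis 2)) | f. f \<in> holomorphic_to_disc ?G \<and> f 0 = 0}"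
  define N where "N = real n"
  \<comment> \<open>A bound strictly below the asserted one, so that the strict inequality survives
    the supremum. In the other direction a single competitor already exceeds the lower
    bound.\<close>
  define B where "B = 2 * ((N\<^sup>2 + 1) / (N * (N\<^sup>2 - 1)) - 1 / (4 * N ^ 3 * (N\<^sup>2 - 1)))"
  have odd: "odd CARD('n)" and n3: "CARD('n) \<ge> 3" and N: "N = real CARD('n)" "N \<ge> 3"
    using assms by (auto simp: N_def)
  have le_B: "x \<le> B" if mem: "x \<in> ?S" for x
  proof -
    obtain f where x: "x = cmod (frechet_derivative f (at 0) (std_basis 2))"
      and f: "f \<in> holomorphic_to_disc ?G" "f 0 = 0"
      using mem by blast
    obtain L where L: "(f has_derivative L) (at 0)" "\<And>c v. L (c *s v) = c * L v"
      using f(1) zero_in_symmetrized_disc unfolding holomorphic_to_disc_def holomorphic_several_def by blast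
    show ?thesis
      unfolding x frechet_derivative_at[OF L(1), symmetric] B_def N(1)
      by (rule second_coefficient_bound[OF odd n3 second_taylor_coefficient[OF f L]])
  qed
  obtain f L where f: "f \<in> holomorphic_to_disc ?G" "f 0 = 0" "(f has_derivative L) (at 0)"
    "2 / (N - 2 / (N + 1)) < cmod (L (std_basis 2))"
    using exists_large_derivative[OF odd n3] unfolding N(1) by blast
  have mem: "cmod (L (std_basis 2)) \<in> ?S"
    using f(1,2) frechet_derivative_at[OF f(3)] by auto
  have "2 / N * (1 + 2 / ((N - 1) * (N + 2))) = 2 / (N - 2 / (N + 1))"
  proof -
    have "N - 2 / (N + 1) = (N - 1) * (N + 2) / (N + 1)"
      using N by (simp add: field_simps)
    moreover have "1 + 2 / ((N - 1) * (N + 2)) = N * (N + 1) / ((N - 1) * (N + 2))"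
    proof -
      have "(N - 1) * (N + 2) \<noteq> 0"
        using N by simp
      then have "1 + 2 / ((N - 1) * (N + 2)) = ((N - 1) * (N + 2) + 2) / ((N - 1) * (N + 2))"
        by (simp add: add_divide_distrib)
      then show ?thesis
        by (simp add: algebra_simps)
    qed
    ultimately show ?thesis
      using N by simp
  qed
  also have "\<dots> < cmod (L (std_basis 2))"
    by (rule f(4))
  also have "\<dots> \<le> Sup ?S"
    by (rule cSup_upper[OF mem bdd_aboveI[OF le_B]])
  finally have lower: "2 / N * (1 + 2 / ((N - 1) * (N + 2))) < Sup ?S" .
  have "Sup ?S \<le> B"
    using mem le_B by (intro cSup_least) auto
  also have "B < 2 * ((N\<^sup>2 + 1) / (N * (N\<^sup>2 - 1)))"
    using N one_less_power[of N 2] by (simp add: B_def)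
  also have "\<dots> = 2 / N * (1 + 2 / ((N - 1) * (N + 1)))"
  proof -
    have "N\<^sup>2 - 1 = (N - 1) * (N + 1)"
      by (simp add: power2_eq_square algebra_simps)
    moreover have "1 + 2 / ((N - 1) * (N + 1)) = (N\<^sup>2 + 1) / ((N - 1) * (N + 1))"
    proof -
      have "(N - 1) * (N + 1) \<noteq> 0"
        using N by simp
      then have "1 + 2 / ((N - 1) * (N + 1)) = ((N - 1) * (N + 1) + 2) / ((N - 1) * (N + 1))"
        by (simp add: add_divide_distrib)
      then show ?thesis
        by (simp add: algebra_simps power2_eq_square)
    qed
    ultimately show ?thesis
      by simp
  qed
  finally show ?thesis
    using lower unfolding caratheodory_reiffen_def N_def by simp
qed

end
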